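(* There exist two Banach spaces $(X,\|\cdot\|_X)$ and $(Y,\|\cdot\|_Y)$, a $1$-net $\mathscr{N}$ of $X$, and a Lipschitz function $f:\mathscr{N}\to Y$ (with respect to the metrics induced by $\|\cdot\|_X$ and $\|\cdot\|_Y$) such that every $F:X\to Y$ that extends $f$ (i.e., $F(x)=f(x)$ for every $x\in\mathscr{N}$) is not uniformly continuous. Moreover, for these same $X,Y,\mathscr{N},f$, any $F:X\to Y$ that is uniformly continuous satisfies $$\sup_{x\in \mathscr{N}} \|F(x)-f(x)\|_Y=\infty.$$
   Context: A $1$-net of a Banach space $(X,\|\cdot\|_X)$ is a subset $\mathscr{N}\subseteq X$ such that $\|x-y\|_X\ge 1$ for all distinct $x,y\in\mathscr{N}$, and for every $x\in X$ there exists $y\in\mathscr{N}$ with $\|x-y\|_X\le 1$. Banach spaces are over the real numbers. *)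

theory Defs
  imports "HOL-Analysis.Analysis" "HOL-Algebra.Module"
begin

definition reals_ring :: "real ring"
  where "reals_ring = \<lparr>carrier = UNIV, mult = (*), one = 1, zero = 0, add = (+)\<rparr>"

lemma cring_reals_ring: "cring reals_ring"
proof (rule cringI)
  show "abelian_group reals_ring"
  proof (rule abelian_groupI)
    show "\<exists>y\<in>carrier reals_ring. y \<oplus>\<^bsub>reals_ring\<^esub> x = \<zero>\<^bsub>reals_ring\<^esub>" for x
      by (rule bexI[of _ "-x"]) (simp_all add: reals_ring_def)
  qed (simp_all add: reals_ring_def)
  show "comm_monoid reals_ring"
    by (rule comm_monoidI) (simp_all add: reals_ring_def)
qed (simp add: reals_ring_def distrib_right)

(* Banach spaces are carried by a subset of a type, with their own operations, so that
   existence of a Banach space can be stated inside the logic, which the type class banach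
   does not allow. Over the type nat => real this covers, up to isomorphism, every Banach
   space of cardinality at most the continuum, in particular every separable one.
   The fields mult and one are inherited from the module record of HOL-Algebra;
   no axiom below mentions them. *)
record 'a normed_module = "(real, 'a) module" +
  vnorm :: "'a \<Rightarrow> real"

locale real_normed_space = module reals_ring X
  for X :: "'a normed_module" (structure) +
  assumes vnorm_eq_0_iff: "x \<in> carrier X \<Longrightarrow> vnorm X x = 0 \<longleftrightarrow> x = \<zero>"
    and vnorm_triangle: "\<lbrakk>x \<in> carrier X; y \<in> carrier X\<rbrakk> \<Longrightarrow> vnorm X (x \<oplus> y) \<le> vnorm X x + vnorm X y"
    and vnorm_smult: "x \<in> carrier X \<Longrightarrow> vnorm X (a \<odot> x) = \<bar>a\<bar> * vnorm X x"

(* The distance is 0 outside the carrier because Metric_space demands nonnegativity and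
   symmetry of the distance on the whole type. *)
definition norm_dist :: "'a normed_module \<Rightarrow> 'a \<Rightarrow> 'a \<Rightarrow> real"
  where "norm_dist X x y =
    (if x \<in> carrier X \<and> y \<in> carrier X then vnorm X (x \<ominus>\<^bsub>X\<^esub> y) else 0)"

definition norm_metric :: "'a normed_module \<Rightarrow> 'a metric"
  where "norm_metric X = metric (carrier X, norm_dist X)"

locale banach_space = real_normed_space +
  assumes complete: "mcomplete_of (norm_metric X)"

definition one_net :: "'a normed_module \<Rightarrow> 'a set \<Rightarrow> bool"
  where "one_net X N \<longleftrightarrow>
    N \<subseteq> carrier X \<and>
    (\<forall>x\<in>N. \<forall>y\<in>N. x \<noteq> y \<longrightarrow> vnorm X (x \<ominus>\<^bsub>X\<^esub> y) \<ge> 1) \<and>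
    (\<forall>x\<in>carrier X. \<exists>y\<in>N. vnorm X (x \<ominus>\<^bsub>X\<^esub> y) \<le> 1)"

context real_normed_space
begin

lemma smult_minus_one:
  assumes x: "x \<in> carrier X"
  shows "(-1) \<odot> x = \<ominus> x"
proof -
  have "(-1) \<odot> x \<oplus> x = \<zero>"
  proof -
    have eq: "((-1) \<oplus>\<^bsub>reals_ring\<^esub> 1) \<odot> x = (-1) \<odot> x \<oplus> 1 \<odot> x"
      using x by (intro smult_l_distr) (auto simp: reals_ring_def)
    have one: "1 \<odot> x = x"
      using smult_one[OF x] by (simp add: reals_ring_def)
    have "0 \<odot> x \<oplus> 0 \<odot> x = 0 \<odot> x"
      using smult_l_distr[of 0 0 x] x by (simp add: reals_ring_def)
    moreover have "0 \<odot> x \<in> carrier X"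
      using smult_closed[of 0 x] x by (simp add: reals_ring_def)
    ultimately have "0 \<odot> x = \<zero>"
      by (metis M.add.l_cancel_one')
    then show ?thesis
      using eq one by (simp add: reals_ring_def)
  qed
  moreover have "(-1) \<odot> x \<in> carrier X"
    using smult_closed[of "-1" x] x by (simp add: reals_ring_def)
  ultimately show ?thesis
    using x by (simp add: M.minus_equality)
qed

lemma vnorm_uminus: "x \<in> carrier X \<Longrightarrow> vnorm X (\<ominus> x) = vnorm X x"
  using vnorm_smult[of x "-1"] by (simp add: smult_minus_one)

lemma vnorm_nonneg:
  assumes "x \<in> carrier X"
  shows "vnorm X x \<ge> 0"
  using vnorm_triangle[of x "\<ominus> x"] vnorm_eq_0_iff[of \<zero>] assms
  by (simp add: vnorm_uminus M.r_neg)

lemma Metric_space_norm_dist: "Metric_space (carrier X) (norm_dist X)"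
proof
  show "0 \<le> norm_dist X x y" for x y
    by (simp add: norm_dist_def vnorm_nonneg)
  show "norm_dist X x y = norm_dist X y x" for x y
  proof (cases "x \<in> carrier X \<and> y \<in> carrier X")
    case True
    then have "y \<ominus> x = \<ominus> (x \<ominus> y)"
      by (simp add: M.minus_eq M.minus_add M.a_comm)
    with True show ?thesis
      by (simp add: norm_dist_def vnorm_uminus)
  qed (auto simp: norm_dist_def)
  show "norm_dist X x y = 0 \<longleftrightarrow> x = y" if "x \<in> carrier X" "y \<in> carrier X" for x y
  proof -
    have "x \<ominus> y = \<zero> \<longleftrightarrow> x = y"
    proof
      assume "x \<ominus> y = \<zero>"
      then have "\<ominus> (\<ominus> y) = x"
        using that by (intro M.minus_equality) (auto simp: M.minus_eq)
      then show "x = y"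
        using that by simp
    qed (use that in \<open>simp add: M.minus_eq M.r_neg\<close>)
    then show ?thesis
      using that by (simp add: norm_dist_def vnorm_eq_0_iff)
  qed
  show "norm_dist X x z \<le> norm_dist X x y + norm_dist X y z"
    if xyz: "x \<in> carrier X" "y \<in> carrier X" "z \<in> carrier X" for x y z
  proof -
    have "x \<ominus> z = (x \<ominus> y) \<oplus> (y \<ominus> z)"
      using xyz by (simp add: M.minus_eq M.a_assoc M.r_neg1)
    then show ?thesis
      using xyz vnorm_triangle[of "x \<ominus> y" "y \<ominus> z"] by (simp add: norm_dist_def)
  qed
qed

lemma mspace_norm_metric: "mspace (norm_metric X) = carrier X"
  unfolding norm_metric_def by (rule Metric_space.mspace_metric[OF Metric_space_norm_dist])

lemma mdist_norm_metric: "mdist (norm_metric X) = norm_dist X"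
  unfolding norm_metric_def by (rule Metric_space.mdist_metric[OF Metric_space_norm_dist])

end

end

theory Submission
  imports Defs
begin

text \<open>
  Let \<open>X\<close> be the space of sequences with \<open>\<Sum>m. \<bar>x m\<bar> / (m + 1) < \<infinity>\<close>, let \<open>Y\<close> be its bounded members,
  normed by this weighted sum plus (up to equivalence) the supremum norm, and let \<open>f\<close> truncate every
  coordinate to \<open>[0, 1]\<close>. Truncation decreases the weighted sum norm and its values have supremum
  distance at most 1, so \<open>f\<close> is Lipschitz at distances at least 1. Suppose that a uniformly continuous
  \<open>F\<close> is close to \<open>f\<close> on a net. Since \<open>F\<close> and \<open>f\<close> are both Lipschitz at large distances, \<open>F\<close> is
  close to \<open>f\<close> on all of \<open>X\<close>. Consider the indicators of the subsets of \<open>{M..<n}\<close> for a large \<open>M\<close>.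
  Flipping a coordinate \<open>m \<ge> M\<close> is a move of length \<open>1 / (m + 1)\<close>, so it changes the coordinate \<open>m\<close> of
  \<open>F\<close> by at most 1/4, whereas it changes that of \<open>f\<close> by 1. Hence the average over all subsets of the
  distance of \<open>F\<close> and \<open>f\<close> is at least \<open>3/8\<close> times the sum of \<open>1 / (m + 1)\<close> over \<open>{M..<n}\<close>, which is
  unbounded because the harmonic series diverges.
\<close>

section \<open>Nets in normed spaces\<close>

text \<open>By Zorn's lemma there is a maximal 1-separated set. It is a net, since a point at
  distance more than 1 from all its members could be added to it.\<close>

lemma (in real_normed_space) one_net_exists: "\<exists>N. one_net X N"
proof -
  define \<A> where "\<A> = {N. N \<subseteq> carrier X \<and> (\<forall>x\<in>N. \<forall>y\<in>N. x \<noteq> y \<longrightarrow> vnorm X (x \<ominus> y) \<ge> 1)}"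
  have "\<Union>\<C> \<in> \<A>" if "subset.chain \<A> \<C>" for \<C>
  proof -
    have sub: "\<C> \<subseteq> \<A>" and total: "\<And>S T. S \<in> \<C> \<Longrightarrow> T \<in> \<C> \<Longrightarrow> S \<subseteq> T \<or> T \<subseteq> S"
      using that by (auto simp: subset_chain_def)
    have "vnorm X (x \<ominus> y) \<ge> 1" if "S \<in> \<C>" "T \<in> \<C>" "x \<in> S" "y \<in> T" "x \<noteq> y" for S T x y
    proof -
      \<comment> \<open>Of two members of a chain one contains the other, so both points lie in a
        common 1-separated set.\<close>
      obtain R where "R \<in> \<C>" "x \<in> R" "y \<in> R"
        using total[of S T] \<open>S \<in> \<C>\<close> \<open>T \<in> \<C>\<close> \<open>x \<in> S\<close> \<open>y \<in> T\<close> by blast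
      then show ?thesis
        using sub \<open>x \<noteq> y\<close> unfolding \<A>_def by blast
    qed
    then show ?thesis
      using sub unfolding \<A>_def by blast
  qed
  then obtain N where N: "N \<in> \<A>" and max: "\<And>M. M \<in> \<A> \<Longrightarrow> N \<subseteq> M \<Longrightarrow> M = N"
    using subset_Zorn'[of \<A>] by blast
  have "\<exists>y\<in>N. vnorm X (x \<ominus> y) \<le> 1" if x: "x \<in> carrier X" for x
  proof (rule ccontr)
    assume *: "\<not> (\<exists>y\<in>N. vnorm X (x \<ominus> y) \<le> 1)"
    have NX: "N \<subseteq> carrier X"
      using N by (simp add: \<A>_def)
    have "vnorm X (y \<ominus> x) = vnorm X (x \<ominus> y)" if "y \<in> N" for y
      using Metric_space.commute[OF Metric_space_norm_dist, of y x] that x NX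
      by (auto simp: norm_dist_def split: if_splits)
    then have "insert x N \<in> \<A>"
      using N x * unfolding \<A>_def by (force simp: not_le)
    then have "x \<in> N"
      using max[of "insert x N"] by blast
    moreover have "vnorm X (x \<ominus> x) = 0"
      using x vnorm_eq_0_iff[of \<zero>] by (simp add: M.minus_eq M.r_neg)
    ultimately show False
      using * by auto
  qed
  then show ?thesis
    using N by (auto simp: one_net_def \<A>_def)
qed

section \<open>Weighted sequence spaces\<close>

text \<open>The supremum over \<open>j\<close> is the norm. For \<open>c = 1\<close> it lies between
  the larger of the supremum norm and the weighted sum, and the total of the two. Each
  \<open>j\<close> involves only finitely many coordinates, so no infinite series has to be
  handled.\<close>

definition psum :: "real \<Rightarrow> (nat \<Rightarrow> real) \<Rightarrow> nat \<Rightarrow> real"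
  where "psum c v j = c * \<bar>v j\<bar> + (\<Sum>m\<le>j. \<bar>v m\<bar> / (real m + 1))"

text \<open>For \<open>c = 0\<close> this is the space \<open>X\<close>, and for \<open>c = 1\<close> it is the space \<open>Y\<close>.\<close>

definition wspace :: "real \<Rightarrow> (nat \<Rightarrow> real) normed_module"
  where "wspace c = \<lparr>carrier = {v. bdd_above (range (psum c v))},
    mult = (\<lambda>_ _ _. 0), one = (\<lambda>_. 0), zero = (\<lambda>_. 0), add = (\<lambda>u v i. u i + v i),
    smult = (\<lambda>a v i. a * v i), vnorm = (\<lambda>v. SUP j. psum c v j)\<rparr>"

lemma psum_triangle:
  assumes "c \<ge> 0"
  shows "psum c (\<lambda>i. u i + v i) j \<le> psum c u j + psum c v j"
proof -
  have "(\<Sum>m\<le>j. \<bar>u m + v m\<bar> / (real m + 1)) \<le> (\<Sum>m\<le>j. \<bar>u m\<bar> / (real m + 1) + \<bar>v m\<bar> / (real m + 1))"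
    by (intro sum_mono) (simp add: add_divide_distrib[symmetric] divide_right_mono)
  moreover have "c * \<bar>u j + v j\<bar> \<le> c * (\<bar>u j\<bar> + \<bar>v j\<bar>)"
    using assms by (intro mult_left_mono) auto
  ultimately show ?thesis
    by (simp add: psum_def sum.distrib distrib_left)
qed

lemma psum_smult: "psum c (\<lambda>i. a * v i) j = \<bar>a\<bar> * psum c v j"
  by (simp add: psum_def abs_mult distrib_left sum_distrib_left mult.left_commute)

lemma psum_0 [simp]: "psum c (\<lambda>_. 0) = (\<lambda>_. 0)"
  by (simp add: psum_def fun_eq_iff)

text \<open>The weighted sum alone controls each coordinate, so this covers \<open>c = 0\<close>
  too. It gives definiteness of the norm and coordinatewise convergence of Cauchy sequences.\<close>

lemma abs_le_psum:
  assumes "c \<ge> 0"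
  shows "\<bar>v j\<bar> \<le> (real j + 1) * psum c v j"
proof -
  have "\<bar>v j\<bar> / (real j + 1) \<le> (\<Sum>m\<le>j. \<bar>v m\<bar> / (real m + 1))"
    by (rule member_le_sum) auto
  also have "\<dots> \<le> psum c v j"
    using assms by (simp add: psum_def)
  finally show ?thesis
    by (simp add: field_simps)
qed

lemma carrier_wspace: "v \<in> carrier (wspace c) \<longleftrightarrow> bdd_above (range (psum c v))"
  by (simp add: wspace_def)

lemma carrier_wspaceI: "(\<And>j. psum c v j \<le> B) \<Longrightarrow> v \<in> carrier (wspace c)"
  by (auto simp: carrier_wspace bdd_above_def)

lemma zero_wspace: "\<zero>\<^bsub>wspace c\<^esub> = (\<lambda>_. 0)"
  and add_wspace: "u \<oplus>\<^bsub>wspace c\<^esub> v = (\<lambda>i. u i + v i)"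
  and smult_wspace: "a \<odot>\<^bsub>wspace c\<^esub> v = (\<lambda>i. a * v i)"
  by (simp_all add: wspace_def)

text \<open>With \<open>psum_le_vnorm\<close>, this reduces norm estimates to estimates of
  \<open>psum\<close> for each fixed \<open>j\<close>.\<close>

lemma vnorm_wspace_le: "(\<And>j. psum c v j \<le> B) \<Longrightarrow> vnorm (wspace c) v \<le> B"
  by (auto simp: wspace_def intro: cSUP_least)

lemma psum_le_vnorm: "v \<in> carrier (wspace c) \<Longrightarrow> psum c v j \<le> vnorm (wspace c) v"
  by (auto simp: wspace_def intro: cSUP_upper)

lemma wspace_add_closed:
  assumes "c \<ge> 0" "u \<in> carrier (wspace c)" "v \<in> carrier (wspace c)"
  shows "(\<lambda>i. u i + v i) \<in> carrier (wspace c)"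
    and "vnorm (wspace c) (\<lambda>i. u i + v i) \<le> vnorm (wspace c) u + vnorm (wspace c) v"
proof -
  have *: "psum c (\<lambda>i. u i + v i) j \<le> vnorm (wspace c) u + vnorm (wspace c) v" for j
    using psum_triangle[of c u v j] psum_le_vnorm[of u c j] psum_le_vnorm[of v c j] assms by linarith
  from * show "(\<lambda>i. u i + v i) \<in> carrier (wspace c)"
    by (rule carrier_wspaceI)
  from * show "vnorm (wspace c) (\<lambda>i. u i + v i) \<le> vnorm (wspace c) u + vnorm (wspace c) v"
    by (rule vnorm_wspace_le)
qed

lemma wspace_smult_le:
  assumes "v \<in> carrier (wspace c)"
  shows "(\<lambda>i. a * v i) \<in> carrier (wspace c)"
    and "vnorm (wspace c) (\<lambda>i. a * v i) \<le> \<bar>a\<bar> * vnorm (wspace c) v"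
proof -
  have *: "psum c (\<lambda>i. a * v i) j \<le> \<bar>a\<bar> * vnorm (wspace c) v" for j
    unfolding psum_smult by (intro mult_left_mono psum_le_vnorm assms) auto
  from * show "(\<lambda>i. a * v i) \<in> carrier (wspace c)"
    by (rule carrier_wspaceI)
  from * show "vnorm (wspace c) (\<lambda>i. a * v i) \<le> \<bar>a\<bar> * vnorm (wspace c) v"
    by (rule vnorm_wspace_le)
qed

lemma vnorm_zero_wspace: "vnorm (wspace c) (\<lambda>_. 0) = 0"
  by (simp add: wspace_def)

text \<open>The inequality \<open>wspace_smult_le\<close>, applied with \<open>inverse a\<close> to
  the multiple by \<open>a\<close>, yields the reverse inequality.\<close>

lemma vnorm_smult_wspace:
  assumes "v \<in> carrier (wspace c)"
  shows "vnorm (wspace c) (\<lambda>i. a * v i) = \<bar>a\<bar> * vnorm (wspace c) v"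
proof (cases "a = 0")
  case False
  have "vnorm (wspace c) (\<lambda>i. inverse a * (a * v i)) \<le> \<bar>inverse a\<bar> * vnorm (wspace c) (\<lambda>i. a * v i)"
    using wspace_smult_le assms by blast
  with False have "\<bar>a\<bar> * vnorm (wspace c) v \<le> vnorm (wspace c) (\<lambda>i. a * v i)"
    by (simp add: mult.assoc[symmetric] field_simps abs_inverse)
  then show ?thesis
    using wspace_smult_le(2)[OF assms, of a] by simp
qed (simp add: vnorm_zero_wspace)

section \<open>Normed space axioms and completeness\<close>

lemma real_normed_space_wspace:
  assumes c: "c \<ge> 0"
  shows "real_normed_space (wspace c)"
proof -
  have "abelian_group (wspace c)"
  proof (rule abelian_groupI)
    show "\<exists>y\<in>carrier (wspace c). y \<oplus>\<^bsub>wspace c\<^esub> x = \<zero>\<^bsub>wspace c\<^esub>" if "x \<in> carrier (wspace c)" for x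
      using wspace_smult_le(1)[OF that, of "-1"]
      by (intro bexI[of _ "\<lambda>i. - 1 * x i"]) (simp_all add: add_wspace zero_wspace)
    show "\<zero>\<^bsub>wspace c\<^esub> \<in> carrier (wspace c)"
      by (simp add: zero_wspace carrier_wspace)
  qed (simp_all add: add_wspace zero_wspace wspace_add_closed(1)[OF c] add_ac)
  then have "module reals_ring (wspace c)"
    by (intro moduleI cring_reals_ring)
      (simp_all add: add_wspace smult_wspace reals_ring_def wspace_smult_le(1) distrib_left
        distrib_right mult.assoc)
  moreover have "vnorm (wspace c) x = 0 \<longleftrightarrow> x = \<zero>\<^bsub>wspace c\<^esub>" if x: "x \<in> carrier (wspace c)" for x
  proof
    assume "vnorm (wspace c) x = 0"
    then have "psum c x j \<le> 0" for j
      using psum_le_vnorm[OF x, of j] by simp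
    then have "\<bar>x j\<bar> \<le> 0" for j
      using abs_le_psum[OF c, of x j]
      by (meson add_nonneg_nonneg mult_nonneg_nonpos of_nat_0_le_iff order_trans zero_le_one)
    then show "x = \<zero>\<^bsub>wspace c\<^esub>"
      by (auto simp: zero_wspace)
  qed (simp add: zero_wspace vnorm_zero_wspace)
  ultimately show ?thesis
    by (intro real_normed_space.intro real_normed_space_axioms.intro)
      (simp_all add: add_wspace smult_wspace wspace_add_closed(2)[OF c] vnorm_smult_wspace)
qed

lemma minus_wspace:
  assumes c: "c \<ge> 0" and v: "v \<in> carrier (wspace c)"
  shows "u \<ominus>\<^bsub>wspace c\<^esub> v = (\<lambda>i. u i - v i)"
proof -
  interpret real_normed_space "wspace c"
    by (rule real_normed_space_wspace[OF c])
  have "\<ominus>\<^bsub>wspace c\<^esub> v = (\<lambda>i. - v i)"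
    using smult_minus_one[OF v] by (simp add: smult_wspace)
  then show ?thesis
    by (simp add: M.minus_eq add_wspace)
qed

lemma wspace_diff_closed:
  assumes c: "c \<ge> 0" and "u \<in> carrier (wspace c)" "v \<in> carrier (wspace c)"
  shows "(\<lambda>i. u i - v i) \<in> carrier (wspace c)"
  using wspace_add_closed(1)[OF c assms(2) wspace_smult_le(1)[OF assms(3), of "-1"]] by simp

lemma norm_dist_wspace:
  assumes "c \<ge> 0" "u \<in> carrier (wspace c)" "v \<in> carrier (wspace c)"
  shows "norm_dist (wspace c) u v = vnorm (wspace c) (\<lambda>i. u i - v i)"
  using assms by (simp add: norm_dist_def minus_wspace)

text \<open>A Cauchy sequence converges in every coordinate. Its Cauchy bounds hold for all
  \<open>j\<close> at once and survive the passage to this limit, which gives convergence in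
  norm.\<close>

lemma banach_space_wspace:
  assumes c: "c \<ge> 0"
  shows "banach_space (wspace c)"
proof -
  interpret real_normed_space "wspace c"
    by (rule real_normed_space_wspace[OF c])
  interpret MS: Metric_space "carrier (wspace c)" "norm_dist (wspace c)"
    by (rule Metric_space_norm_dist)
  have "\<exists>x. limitin MS.mtopology \<sigma> x sequentially" if "MS.MCauchy \<sigma>" for \<sigma>
  proof -
    have mem: "\<sigma> n \<in> carrier (wspace c)" for n
      using that by (auto simp: MS.MCauchy_def)
    have cauchy: "\<exists>N. \<forall>n\<ge>N. \<forall>n'\<ge>N. \<forall>j. psum c (\<lambda>i. \<sigma> n i - \<sigma> n' i) j < e" if "e > 0" for e
    proof -
      obtain N where "\<forall>n n'. N \<le> n \<longrightarrow> N \<le> n' \<longrightarrow> norm_dist (wspace c) (\<sigma> n) (\<sigma> n') < e"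
        using \<open>MS.MCauchy \<sigma>\<close> \<open>e > 0\<close> unfolding MS.MCauchy_def by meson
      then show ?thesis
        using psum_le_vnorm[OF wspace_diff_closed[OF c mem mem]]
        by (metis norm_dist_wspace[OF c mem mem] order_le_less_trans)
    qed
    have "Cauchy (\<lambda>n. \<sigma> n i)" for i
    proof (rule CauchyI)
      fix e :: real assume "e > 0"
      then obtain N where N: "\<forall>n\<ge>N. \<forall>n'\<ge>N. \<forall>j. psum c (\<lambda>i. \<sigma> n i - \<sigma> n' i) j < e / (real i + 1)"
        using cauchy[of "e / (real i + 1)"] by auto
      have "norm (\<sigma> m i - \<sigma> n i) < e" if "m \<ge> N" "n \<ge> N" for m n
      proof -
        have "\<bar>\<sigma> m i - \<sigma> n i\<bar> \<le> (real i + 1) * psum c (\<lambda>i. \<sigma> m i - \<sigma> n i) i"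
          using abs_le_psum[OF c, of "\<lambda>i. \<sigma> m i - \<sigma> n i" i] .
        also have "\<dots> < (real i + 1) * (e / (real i + 1))"
          using N that by (intro mult_strict_left_mono) auto
        also have "\<dots> = e"
          by (simp add: field_simps)
        finally show ?thesis
          by simp
      qed
      then show "\<exists>M. \<forall>m\<ge>M. \<forall>n\<ge>M. norm (\<sigma> m i - \<sigma> n i) < e"
        by blast
    qed
    then have "\<forall>i. \<exists>l. (\<lambda>n. \<sigma> n i) \<longlonglongrightarrow> l"
      by (simp add: real_Cauchy_convergent convergent_def[symmetric])
    then obtain l where l: "\<And>i. (\<lambda>n. \<sigma> n i) \<longlonglongrightarrow> l i"
      by metis
    have close: "\<exists>N. \<forall>n\<ge>N. \<forall>j. psum c (\<lambda>i. \<sigma> n i - l i) j \<le> e" if e: "e > 0" for e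
    proof -
      obtain N where N: "\<forall>n\<ge>N. \<forall>n'\<ge>N. \<forall>j. psum c (\<lambda>i. \<sigma> n i - \<sigma> n' i) j < e"
        using cauchy[OF e] by blast
      have "psum c (\<lambda>i. \<sigma> n i - l i) j \<le> e" if "n \<ge> N" for n j
      proof (rule tendsto_upperbound)
        \<comment> \<open>For fixed \<open>j\<close> this is a finite expression in the coordinates,
          so their convergence suffices.\<close>
        show "(\<lambda>n'. psum c (\<lambda>i. \<sigma> n i - \<sigma> n' i) j) \<longlonglongrightarrow> psum c (\<lambda>i. \<sigma> n i - l i) j"
          unfolding psum_def by (intro tendsto_intros l) auto
        show "\<forall>\<^sub>F n' in sequentially. psum c (\<lambda>i. \<sigma> n i - \<sigma> n' i) j \<le> e"
          using N that less_imp_le unfolding eventually_sequentially by blast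
      qed auto
      then show ?thesis
        by blast
    qed
    have "l \<in> carrier (wspace c)"
    proof -
      obtain N where "\<forall>j. psum c (\<lambda>i. \<sigma> N i - l i) j \<le> 1"
        using close[of 1] by auto
      then have "(\<lambda>i. \<sigma> N i - l i) \<in> carrier (wspace c)"
        by (blast intro: carrier_wspaceI)
      \<comment> \<open>The limit is \<sigma> \<open>N\<close> minus the difference just shown to
        lie in the space.\<close>
      from wspace_diff_closed[OF c mem[of N] this] show ?thesis
        by simp
    qed
    moreover have "\<forall>\<^sub>F n in sequentially. norm_dist (wspace c) (\<sigma> n) l < e" if "e > 0" for e
    proof -
      obtain N where N: "\<forall>n\<ge>N. \<forall>j. psum c (\<lambda>i. \<sigma> n i - l i) j \<le> e / 2"
        using close[of "e / 2"] \<open>e > 0\<close> by auto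
      have "norm_dist (wspace c) (\<sigma> n) l < e" if "n \<ge> N" for n
      proof -
        have "norm_dist (wspace c) (\<sigma> n) l \<le> e / 2"
          unfolding norm_dist_wspace[OF c mem \<open>l \<in> carrier (wspace c)\<close>]
          using N that by (intro vnorm_wspace_le) auto
        then show ?thesis
          using \<open>e > 0\<close> by simp
      qed
      then show ?thesis
        unfolding eventually_sequentially by blast
    qed
    ultimately show ?thesis
      using mem by (auto simp: MS.limitin_metric)
  qed
  then have "mcomplete_of (norm_metric (wspace c))"
    by (simp add: norm_metric_def MS.mcomplete_def)
  then show ?thesis
    by unfold_locales
qed

section \<open>The truncation map\<close>

definition clamp01 :: "(nat \<Rightarrow> real) \<Rightarrow> nat \<Rightarrow> real"
  where "clamp01 x = (\<lambda>i. max 0 (min 1 (x i)))"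

text \<open>Truncation is 1-Lipschitz in each coordinate, which bounds the weighted sums. The term
  with factor \<open>c = 1\<close> compares two numbers in [0, 1] and costs at most 1.\<close>

lemma psum_clamp01_diff:
  "psum 1 (\<lambda>i. clamp01 x i - clamp01 y i) j \<le> 1 + psum 0 (\<lambda>i. x i - y i) j"
proof -
  have "(\<Sum>m\<le>j. \<bar>clamp01 x m - clamp01 y m\<bar> / (real m + 1)) \<le> (\<Sum>m\<le>j. \<bar>x m - y m\<bar> / (real m + 1))"
    by (intro sum_mono divide_right_mono) (auto simp: clamp01_def)
  moreover have "\<bar>clamp01 x j - clamp01 y j\<bar> \<le> 1"
    by (auto simp: clamp01_def)
  ultimately show ?thesis
    by (simp add: psum_def)
qed

lemma clamp01_closed:
  assumes "x \<in> carrier (wspace 0)"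
  shows "clamp01 x \<in> carrier (wspace 1)"
proof (rule carrier_wspaceI)
  show "psum 1 (clamp01 x) j \<le> 1 + vnorm (wspace 0) x" for j
    using psum_clamp01_diff[of x "\<lambda>_. 0" j] psum_le_vnorm[OF assms, of j]
    by (simp add: clamp01_def)
qed

lemma norm_dist_clamp01:
  assumes "x \<in> carrier (wspace 0)" "y \<in> carrier (wspace 0)"
  shows "norm_dist (wspace 1) (clamp01 x) (clamp01 y) \<le> 1 + norm_dist (wspace 0) x y"
proof -
  have "psum 1 (\<lambda>i. clamp01 x i - clamp01 y i) j \<le> 1 + vnorm (wspace 0) (\<lambda>i. x i - y i)" for j
    using psum_clamp01_diff[of x y j] psum_le_vnorm[OF wspace_diff_closed[OF _ assms], of j] by simp
  then show ?thesis
    using vnorm_wspace_le by (simp add: norm_dist_wspace clamp01_closed assms)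
qed

text \<open>Distinct net points have distance at least 1, so the additive 1 in
  \<open>norm_dist_clamp01\<close> is absorbed into the Lipschitz constant 2.\<close>

lemma Lipschitz_clamp01:
  assumes N: "one_net (wspace 0) N"
  shows "Lipschitz_continuous_map (submetric (norm_metric (wspace 0)) N) (norm_metric (wspace 1)) clamp01"
proof -
  interpret X: real_normed_space "wspace 0"
    by (rule real_normed_space_wspace) simp
  interpret Y: real_normed_space "wspace 1"
    by (rule real_normed_space_wspace) simp
  interpret DY: Metric_space "carrier (wspace 1)" "norm_dist (wspace 1)"
    by (rule Y.Metric_space_norm_dist)
  have "norm_dist (wspace 1) (clamp01 x) (clamp01 y) \<le> 2 * norm_dist (wspace 0) x y"
    if "x \<in> N" "y \<in> N" for x y
  proof (cases "x = y")
    case True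
    then show ?thesis
      using that N clamp01_closed[of y] Metric_space.nonneg[OF X.Metric_space_norm_dist, of y y]
      by (auto simp: one_net_def)
  next
    case False
    have *: "x \<in> carrier (wspace 0)" "y \<in> carrier (wspace 0)"
      using that N by (auto simp: one_net_def)
    then have "norm_dist (wspace 0) x y \<ge> 1"
      using that N False by (auto simp: one_net_def norm_dist_def)
    then show ?thesis
      using norm_dist_clamp01[OF *] by simp
  qed
  then show ?thesis
    unfolding Lipschitz_continuous_map_def
    by (auto simp: X.mspace_norm_metric X.mdist_norm_metric Y.mspace_norm_metric Y.mdist_norm_metric
        clamp01_closed)
qed

section \<open>Uniformly continuous maps near the truncation map\<close>

text \<open>A segment of length at most 1 splits into \<open>n\<close> steps shorter than \<delta>,
  with \<open>n\<close> independent of the segment. Each step moves the image by at most \<epsilon>,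
  so \<open>K\<close> can be \<open>n\<close> times \<epsilon>.\<close>

lemma uniformly_continuous_wspace_bounded:
  assumes c: "c \<ge> 0" "d \<ge> 0" and F: "F \<in> carrier (wspace c) \<rightarrow> carrier (wspace d)"
    and uc: "\<And>x y. x \<in> carrier (wspace c) \<Longrightarrow> y \<in> carrier (wspace c) \<Longrightarrow>
      norm_dist (wspace c) x y < \<delta> \<Longrightarrow> norm_dist (wspace d) (F x) (F y) \<le> \<epsilon>"
    and "\<delta> > 0"
  obtains K where "\<And>x y. x \<in> carrier (wspace c) \<Longrightarrow> y \<in> carrier (wspace c) \<Longrightarrow>
      norm_dist (wspace c) x y \<le> 1 \<Longrightarrow> norm_dist (wspace d) (F x) (F y) \<le> K"
proof -
  interpret Y: real_normed_space "wspace d"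
    by (rule real_normed_space_wspace[OF c(2)])
  interpret DY: Metric_space "carrier (wspace d)" "norm_dist (wspace d)"
    by (rule Y.Metric_space_norm_dist)
  obtain n :: nat where n: "1 / \<delta> < real n"
    using reals_Archimedean2 by blast
  then have "n > 0"
    using \<open>\<delta> > 0\<close> by (metis gr0I less_asym of_nat_0 zero_less_divide_1_iff)
  have step: "1 / real n < \<delta>"
    using n \<open>n > 0\<close> \<open>\<delta> > 0\<close> by (simp add: field_simps)
  have "norm_dist (wspace d) (F x) (F y) \<le> real n * \<epsilon>"
    if x: "x \<in> carrier (wspace c)" and y: "y \<in> carrier (wspace c)"
      and xy: "norm_dist (wspace c) x y \<le> 1" for x y
  proof -
    \<comment> \<open>Equally spaced points on the segment from \<open>x = z 0\<close> to
      \<open>y = z n\<close>.\<close>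
    define z where "z k = (\<lambda>i. x i + (real k / real n) * (y i - x i))" for k
    have diff: "(\<lambda>i. y i - x i) \<in> carrier (wspace c)"
      by (rule wspace_diff_closed[OF c(1) y x])
    have z: "z k \<in> carrier (wspace c)" for k
      unfolding z_def by (intro wspace_add_closed(1)[OF c(1) x] wspace_smult_le(1)[OF diff])
    have "norm_dist (wspace c) (z k) (z (Suc k)) < \<delta>" for k
    proof -
      have "(\<lambda>i. z k i - z (Suc k) i) = (\<lambda>i. (1 / real n) * (x i - y i))"
        using \<open>n > 0\<close> by (auto simp: z_def field_simps)
      then have "norm_dist (wspace c) (z k) (z (Suc k)) = (1 / real n) * norm_dist (wspace c) x y"
        using vnorm_smult_wspace[OF wspace_diff_closed[OF c(1) x y], of "1 / real n"]
        by (simp add: norm_dist_wspace[OF c(1)] x y z)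
      also have "\<dots> \<le> 1 / real n"
        using mult_left_mono[OF xy, of "1 / real n"] by simp
      finally show ?thesis
        using step by simp
    qed
    then have Fstep: "norm_dist (wspace d) (F (z k)) (F (z (Suc k))) \<le> \<epsilon>" for k
      using uc z by blast
    have "norm_dist (wspace d) (F (z 0)) (F (z k)) \<le> real k * \<epsilon>" for k
    proof (induction k)
      case 0
      then show ?case
        using F z by (auto simp: Pi_iff)
    next
      case (Suc k)
      have "F (z i) \<in> carrier (wspace d)" for i
        using F z by blast
      then have "norm_dist (wspace d) (F (z 0)) (F (z (Suc k)))
          \<le> norm_dist (wspace d) (F (z 0)) (F (z k)) + norm_dist (wspace d) (F (z k)) (F (z (Suc k)))"
        by (intro DY.triangle)
      then show ?case
        using Suc Fstep[of k] by (simp add: algebra_simps)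
    qed
    from this[of n] show ?thesis
      using \<open>n > 0\<close> by (simp add: z_def)
  qed
  then show thesis
    using that by blast
qed

section \<open>Harmonic tails and averages over subsets\<close>

text \<open>A bound on the sums starting at \<open>M\<close> would bound all partial sums and make
  the harmonic series converge.\<close>

lemma harmonic_unbounded:
  obtains n where "n \<ge> M" "(\<Sum>m\<in>{M..<n}. 1 / (real m + 1)) > B"
proof -
  have "\<exists>n\<ge>M. (\<Sum>m\<in>{M..<n}. 1 / (real m + 1)) > B"
  proof (rule ccontr)
    assume *: "\<not> (\<exists>n\<ge>M. (\<Sum>m\<in>{M..<n}. 1 / (real m + 1)) > B)"
    have "(\<Sum>m<n. 1 / (real m + 1)) \<le> (\<Sum>m<M. 1 / (real m + 1)) + B" for n
    proof -
      \<comment> \<open>Passing to \<open>M + n\<close> also covers \<open>n < M\<close>, where the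
        assumed bound says nothing.\<close>
      have "(\<Sum>m<n. 1 / (real m + 1)) \<le> (\<Sum>m<M + n. 1 / (real m + 1))"
        by (intro sum_mono2) auto
      also have "{..<M + n} = {..<M} \<union> {M..<M + n}"
        by auto
      also have "(\<Sum>m\<in>{..<M} \<union> {M..<M + n}. 1 / (real m + 1))
          = (\<Sum>m<M. 1 / (real m + 1)) + (\<Sum>m\<in>{M..<M + n}. 1 / (real m + 1))"
        by (intro sum.union_disjoint) auto
      also have "\<dots> \<le> (\<Sum>m<M. 1 / (real m + 1)) + B"
        using * by (simp add: not_less)
      finally show ?thesis .
    qed
    then have "summable (\<lambda>m. 1 / (real m + 1))"
      by (intro summableI_nonneg_bounded) auto
    moreover have "(\<lambda>m. 1 / (real m + 1)) = (\<lambda>m. inverse (real (Suc m)))"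
      by (simp add: fun_eq_iff inverse_eq_divide add.commute)
    ultimately have "summable (\<lambda>m. inverse (real m))"
      using summable_Suc_iff[of "\<lambda>m. inverse (real m)"] by simp
    then show False
      using not_summable_harmonic[where 'a = real] by blast
  qed
  then show thesis
    using that by blast
qed

text \<open>Flipping the membership of \<open>m\<close> is an involution of
  \<open>Pow I\<close>.\<close>

lemma sum_Pow_flip:
  fixes g :: "'a set \<Rightarrow> 'b :: comm_monoid_add"
  assumes "m \<in> I"
  shows "(\<Sum>S\<in>Pow I. g (sym_diff S {m})) = (\<Sum>S\<in>Pow I. g S)"
proof (rule sum.reindex_bij_witness[where i = "\<lambda>S. sym_diff S {m}" and j = "\<lambda>S. sym_diff S {m}"])
qed (use assms in auto)

text \<open>The two summands for \<open>S\<close> and for \<open>S\<close> with \<open>m\<close> flipped add up to at least 3/4.\<close>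

lemma average_flip:
  fixes g :: "'a set \<Rightarrow> real"
  assumes I: "finite I" "m \<in> I"
    and flip: "\<And>S. S \<subseteq> I \<Longrightarrow> \<bar>g S - g (sym_diff S {m})\<bar> \<le> 1 / 4"
  shows "(\<Sum>S\<in>Pow I. \<bar>g S - indicator S m\<bar>) \<ge> 3 / 8 * 2 ^ card I"
proof -
  have "(\<Sum>S\<in>Pow I. 3 / 4) \<le> (\<Sum>S\<in>Pow I. \<bar>g S - indicator S m\<bar>
      + \<bar>g (sym_diff S {m}) - indicator (sym_diff S {m}) m\<bar>)"
  proof (rule sum_mono)
    fix S assume "S \<in> Pow I"
    then have "\<bar>g S - g (sym_diff S {m})\<bar> \<le> 1 / 4"
      using flip by simp
    moreover have "\<bar>indicator S m - indicator (sym_diff S {m}) m\<bar> = (1 :: real)"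
      by (auto simp: indicator_def)
    ultimately show "3 / 4 \<le> \<bar>g S - indicator S m\<bar>
        + \<bar>g (sym_diff S {m}) - indicator (sym_diff S {m}) m\<bar>"
      by linarith
  qed
  \<comment> \<open>The flipped summands have the same total as the others; halving 3/4 gives the
    constant 3/8.\<close>
  also have "\<dots> = 2 * (\<Sum>S\<in>Pow I. \<bar>g S - indicator S m\<bar>)"
    using sum_Pow_flip[OF I(2), of "\<lambda>S. \<bar>g S - indicator S m\<bar>"] by (simp add: sum.distrib)
  finally show ?thesis
    using I by (simp add: card_Pow)
qed

text \<open>Both claims of the theorem follow: \<open>C = 0\<close> rules out uniformly continuous
  extensions, and arbitrary \<open>C\<close> makes the supremum infinite.\<close>

lemma uniformly_continuous_far_from_clamp01:
  assumes F: "F \<in> carrier (wspace 0) \<rightarrow> carrier (wspace 1)"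
    and uc: "uniformly_continuous_map (norm_metric (wspace 0)) (norm_metric (wspace 1)) F"
    and N: "one_net (wspace 0) N"
  shows "\<exists>p\<in>N. norm_dist (wspace 1) (F p) (clamp01 p) > C"
proof (rule ccontr)
  assume "\<not> ?thesis"
  then have close: "norm_dist (wspace 1) (F p) (clamp01 p) \<le> C" if "p \<in> N" for p
    using that by (auto simp: not_less)
  interpret X: real_normed_space "wspace 0"
    by (rule real_normed_space_wspace) simp
  interpret Y: real_normed_space "wspace 1"
    by (rule real_normed_space_wspace) simp
  interpret DX: Metric_space "carrier (wspace 0)" "norm_dist (wspace 0)"
    by (rule X.Metric_space_norm_dist)
  interpret DY: Metric_space "carrier (wspace 1)" "norm_dist (wspace 1)"
    by (rule Y.Metric_space_norm_dist)
  have "(1 / 4 :: real) > 0"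
    by simp
  then obtain \<delta> where "\<delta> > 0" and \<delta>: "\<And>x y. x \<in> carrier (wspace 0) \<Longrightarrow> y \<in> carrier (wspace 0) \<Longrightarrow>
      norm_dist (wspace 0) x y < \<delta> \<Longrightarrow> norm_dist (wspace 1) (F x) (F y) < 1 / 4"
    using uc unfolding uniformly_continuous_map_def X.mspace_norm_metric X.mdist_norm_metric
      Y.mdist_norm_metric by meson
  have \<delta>': "norm_dist (wspace 1) (F x) (F y) \<le> 1 / 4"
    if "x \<in> carrier (wspace 0)" "y \<in> carrier (wspace 0)" "norm_dist (wspace 0) x y < \<delta>" for x y
    using \<delta>[OF that] by simp
  obtain K where K: "\<And>x y. x \<in> carrier (wspace 0) \<Longrightarrow> y \<in> carrier (wspace 0) \<Longrightarrow>
      norm_dist (wspace 0) x y \<le> 1 \<Longrightarrow> norm_dist (wspace 1) (F x) (F y) \<le> K"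
    using uniformly_continuous_wspace_bounded[OF _ _ F \<delta>' \<open>\<delta> > 0\<close>] by auto
  \<comment> \<open>Going from \<open>F x\<close> to \<open>clamp01 x\<close> through
    \<open>F p\<close> and \<open>clamp01 p\<close>, for a net point \<open>p\<close> within 1 of
    \<open>x\<close>, costs at most \<open>K\<close>, then \<open>C\<close>, then
    \<open>1 + 1\<close>.\<close>
  define B where "B = K + C + 2"
  have B: "norm_dist (wspace 1) (F x) (clamp01 x) \<le> B" if x: "x \<in> carrier (wspace 0)" for x
  proof -
    obtain p where "p \<in> N" and "vnorm (wspace 0) (x \<ominus>\<^bsub>wspace 0\<^esub> p) \<le> 1"
      using N x by (auto simp: one_net_def)
    moreover have p: "p \<in> carrier (wspace 0)"
      using N \<open>p \<in> N\<close> by (auto simp: one_net_def)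
    ultimately have xp: "norm_dist (wspace 0) x p \<le> 1"
      using x by (simp add: norm_dist_def)
    have "norm_dist (wspace 1) (F x) (clamp01 x) \<le> norm_dist (wspace 1) (F x) (F p)
        + (norm_dist (wspace 1) (F p) (clamp01 p) + norm_dist (wspace 1) (clamp01 p) (clamp01 x))"
      using DY.triangle[of "F x" "F p" "clamp01 x"] DY.triangle[of "F p" "clamp01 p" "clamp01 x"]
        F x p clamp01_closed by fastforce
    moreover have "norm_dist (wspace 1) (clamp01 p) (clamp01 x) \<le> 1 + norm_dist (wspace 0) x p"
      using norm_dist_clamp01[OF p x] by (simp add: DX.commute)
    ultimately show ?thesis
      using K[OF x p xp] close[OF \<open>p \<in> N\<close>] xp by (simp add: B_def)
  qed
  \<comment> \<open>Beyond \<open>M\<close> every weight is smaller than \<delta>. The bound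
    \<open>8 / 3 * B\<close> on the tail is chosen against the factor 3/8 from
    \<open>average_flip\<close>.\<close>
  obtain M :: nat where M: "1 / \<delta> < real M"
    using reals_Archimedean2 by blast
  obtain n where "n \<ge> M" and n: "(\<Sum>m\<in>{M..<n}. 1 / (real m + 1)) > 8 / 3 * B"
    by (rule harmonic_unbounded)
  define I where "I = {M..<n}"
  have Ifin: "finite I"
    by (simp add: I_def)
  define \<phi> where "\<phi> S = (indicator S :: nat \<Rightarrow> real)" for S
  have \<phi>X: "\<phi> S \<in> carrier (wspace 0)" if S: "S \<subseteq> I" for S
  proof (rule carrier_wspaceI)
    fix j
    have "psum 0 (\<phi> S) j = (\<Sum>m\<in>{..j} \<inter> S. 1 / (real m + 1))"
      by (auto simp: psum_def \<phi>_def indicator_def sum.inter_restrict intro!: sum.cong)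
    also have "\<dots> \<le> (\<Sum>m\<in>I. 1 / (real m + 1))"
      using S Ifin by (intro sum_mono2) auto
    finally show "psum 0 (\<phi> S) j \<le> (\<Sum>m\<in>I. 1 / (real m + 1))" .
  qed
  have clamp: "clamp01 (\<phi> S) = \<phi> S" for S
    by (auto simp: clamp01_def \<phi>_def indicator_def)
  have flip: "\<bar>F (\<phi> S) m - F (\<phi> (sym_diff S {m})) m\<bar> \<le> 1 / 4" if S: "S \<subseteq> I" and m: "m \<in> I" for S m
  proof -
    define T where "T = sym_diff S {m}"
    have T: "T \<subseteq> I"
      using S m by (auto simp: T_def)
    have "vnorm (wspace 0) (\<lambda>i. \<phi> S i - \<phi> T i) \<le> 1 / (real m + 1)"
    proof (rule vnorm_wspace_le)
      fix j
      \<comment> \<open>The two indicators differ only at \<open>m\<close>, so the weighted sum has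
        at most one nonzero term.\<close>
      have "\<bar>\<phi> S i - \<phi> T i\<bar> / (real i + 1) = (if i = m then 1 / (real m + 1) else 0)" for i
        by (cases "i \<in> S") (auto simp: \<phi>_def T_def)
      then have "psum 0 (\<lambda>i. \<phi> S i - \<phi> T i) j = (\<Sum>i\<le>j. if i = m then 1 / (real m + 1) else 0)"
        by (simp add: psum_def)
      then show "psum 0 (\<lambda>i. \<phi> S i - \<phi> T i) j \<le> 1 / (real m + 1)"
        by simp
    qed
    also have "1 / (real m + 1) < \<delta>"
    proof -
      have "1 / \<delta> < real m + 1"
        using M m by (simp add: I_def)
      then show ?thesis
        using \<open>\<delta> > 0\<close> by (simp add: field_simps)
    qed
    finally have "norm_dist (wspace 1) (F (\<phi> S)) (F (\<phi> T)) \<le> 1 / 4"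
      using \<delta>' \<phi>X S T by (simp add: norm_dist_wspace)
    moreover have FS: "F (\<phi> S) \<in> carrier (wspace 1)" "F (\<phi> T) \<in> carrier (wspace 1)"
      using F \<phi>X S T by blast+
    \<comment> \<open>This is where the supremum part of the norm of the target enters: it controls
      the coordinate \<open>m\<close> without the weight.\<close>
    moreover have "\<bar>F (\<phi> S) m - F (\<phi> T) m\<bar> \<le> psum 1 (\<lambda>i. F (\<phi> S) i - F (\<phi> T) i) m"
      by (simp add: psum_def sum_nonneg)
    moreover have "\<dots> \<le> vnorm (wspace 1) (\<lambda>i. F (\<phi> S) i - F (\<phi> T) i)"
      using FS by (intro psum_le_vnorm wspace_diff_closed) auto
    ultimately show ?thesis
      unfolding T_def[symmetric] by (simp add: norm_dist_wspace)
  qed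
  \<comment> \<open>The weighted errors are summed over all \<open>S\<close> and \<open>m\<close> in
    two ways: coordinate by coordinate they are bounded below by \<open>average_flip\<close>, and
    subset by subset above by \<open>B\<close>.\<close>
  have "3 / 8 * 2 ^ card I * (\<Sum>m\<in>I. 1 / (real m + 1))
      = (\<Sum>m\<in>I. (3 / 8 * 2 ^ card I) / (real m + 1))"
    by (simp add: sum_distrib_left)
  also have "\<dots> \<le> (\<Sum>m\<in>I. (\<Sum>S\<in>Pow I. \<bar>F (\<phi> S) m - \<phi> S m\<bar>) / (real m + 1))"
  proof (intro sum_mono divide_right_mono)
    fix m assume m: "m \<in> I"
    show "3 / 8 * 2 ^ card I \<le> (\<Sum>S\<in>Pow I. \<bar>F (\<phi> S) m - \<phi> S m\<bar>)"
      using average_flip[OF Ifin m, of "\<lambda>S. F (\<phi> S) m"] flip[OF _ m] by (simp add: \<phi>_def)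
  qed simp
  also have "\<dots> = (\<Sum>S\<in>Pow I. \<Sum>m\<in>I. \<bar>F (\<phi> S) m - \<phi> S m\<bar> / (real m + 1))"
    unfolding sum_divide_distrib by (rule sum.swap)
  also have "\<dots> \<le> (\<Sum>S\<in>Pow I. B)"
  proof (rule sum_mono)
    fix S assume "S \<in> Pow I"
    then have S: "\<phi> S \<in> carrier (wspace 0)"
      using \<phi>X by blast
    have FS: "F (\<phi> S) \<in> carrier (wspace 1)" "\<phi> S \<in> carrier (wspace 1)"
      using F S clamp01_closed[OF S] by (auto simp: clamp)
    \<comment> \<open>Now the weighted part of the norm is used, with the index \<open>n\<close>
      reaching past all of \<open>I\<close>.\<close>
    have "(\<Sum>m\<in>I. \<bar>F (\<phi> S) m - \<phi> S m\<bar> / (real m + 1))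
        \<le> (\<Sum>m\<le>n. \<bar>F (\<phi> S) m - \<phi> S m\<bar> / (real m + 1))"
      by (intro sum_mono2) (auto simp: I_def)
    also have "\<dots> \<le> psum 1 (\<lambda>i. F (\<phi> S) i - \<phi> S i) n"
      by (simp add: psum_def)
    also have "\<dots> \<le> vnorm (wspace 1) (\<lambda>i. F (\<phi> S) i - \<phi> S i)"
      using FS by (intro psum_le_vnorm wspace_diff_closed) auto
    also have "\<dots> \<le> B"
      using B[OF S] FS by (simp add: clamp norm_dist_wspace)
    finally show "(\<Sum>m\<in>I. \<bar>F (\<phi> S) m - \<phi> S m\<bar> / (real m + 1)) \<le> B" .
  qed
  also have "\<dots> = 2 ^ card I * B"
    using Ifin by (simp add: card_Pow)
  finally have "2 ^ card I * (3 / 8 * (\<Sum>m\<in>I. 1 / (real m + 1))) \<le> 2 ^ card I * B"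
    by (simp add: mult_ac)
  then have "3 / 8 * (\<Sum>m\<in>I. 1 / (real m + 1)) \<le> B"
    by (rule mult_left_le_imp_le) simp
  then show False
    using n by (simp add: I_def)
qed

section \<open>Assembling the two spaces, the net and the map\<close>

theorem theorem1:
  shows "\<exists>(X :: (nat \<Rightarrow> real) normed_module) (Y :: (nat \<Rightarrow> real) normed_module) N f.
    banach_space X \<and> banach_space Y \<and> one_net X N \<and>
    Lipschitz_continuous_map (submetric (norm_metric X) N) (norm_metric Y) f \<and>
    (\<forall>F \<in> carrier X \<rightarrow> carrier Y. (\<forall>x\<in>N. F x = f x) \<longrightarrow>
      \<not> uniformly_continuous_map (norm_metric X) (norm_metric Y) F) \<and>
    (\<forall>F \<in> carrier X \<rightarrow> carrier Y.
      uniformly_continuous_map (norm_metric X) (norm_metric Y) F \<longrightarrow>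
      (SUP x\<in>N. ereal (vnorm Y (F x \<ominus>\<^bsub>Y\<^esub> f x))) = \<infinity>)"
proof -
  interpret X: real_normed_space "wspace 0"
    by (rule real_normed_space_wspace) simp
  interpret Y: real_normed_space "wspace 1"
    by (rule real_normed_space_wspace) simp
  interpret DY: Metric_space "carrier (wspace 1)" "norm_dist (wspace 1)"
    by (rule Y.Metric_space_norm_dist)
  obtain N where N: "one_net (wspace 0) N"
    using X.one_net_exists by blast
  have NX: "x \<in> carrier (wspace 0)" if "x \<in> N" for x
    using N that by (auto simp: one_net_def)
  have not_uc: "\<not> uniformly_continuous_map (norm_metric (wspace 0)) (norm_metric (wspace 1)) F"
    if F: "F \<in> carrier (wspace 0) \<rightarrow> carrier (wspace 1)" "\<forall>x\<in>N. F x = clamp01 x" for F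
  proof
    assume "uniformly_continuous_map (norm_metric (wspace 0)) (norm_metric (wspace 1)) F"
    \<comment> \<open>An extension has distance 0 from the truncation map at every net
      point.\<close>
    from uniformly_continuous_far_from_clamp01[OF F(1) this N, of 0]
    show False
      using F(2) clamp01_closed NX by fastforce
  qed
  have sup: "(SUP x\<in>N. ereal (vnorm (wspace 1) (F x \<ominus>\<^bsub>wspace 1\<^esub> clamp01 x))) = \<infinity>"
    if F: "F \<in> carrier (wspace 0) \<rightarrow> carrier (wspace 1)"
      and uc: "uniformly_continuous_map (norm_metric (wspace 0)) (norm_metric (wspace 1)) F" for F
  proof (rule ereal_top)
    fix C
    obtain p where "p \<in> N" "norm_dist (wspace 1) (F p) (clamp01 p) > C"
      using uniformly_continuous_far_from_clamp01[OF F uc N] by blast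
    moreover have "F p \<in> carrier (wspace 1)" "clamp01 p \<in> carrier (wspace 1)"
      using F NX[OF \<open>p \<in> N\<close>] clamp01_closed by auto
    ultimately show "ereal C \<le> (SUP x\<in>N. ereal (vnorm (wspace 1) (F x \<ominus>\<^bsub>wspace 1\<^esub> clamp01 x)))"
      by (intro SUP_upper2[of p]) (auto simp: norm_dist_def)
  qed
  show ?thesis
    by (intro exI[of _ "wspace 0"] exI[of _ "wspace 1"] exI[of _ N] exI[of _ clamp01] conjI)
      (use not_uc sup N in \<open>auto simp: banach_space_wspace Lipschitz_clamp01\<close>)
qed

end
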